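(* Let $A$ and $b$ be as in the context, and let $x_*$ be the unique solution of $Ax-\|x\|_1x=b$ such that $\|x_*\|_1<1-\|a\|_{W}$. Then the sequence $\{u_k\}_{k\ge 0}$ generated by $$\begin{aligned} c_{k+1}&=c_k(1-v_k^Tu_k)^{-1}c_k,\\ u_{k+1}&=u_k+c_kF_k(I-u_kv_k^T)^{-1}u_k,\\ v_{k+1}&=v_k+c_k(1-v_k^Tu_k)^{-1}F_k^Tv_k,\\ F_{k+1}&=F_k(I-u_kv_k^T)^{-1}F_k, \end{aligned}$$ with $c_0=\mathbf 1^TA^{-1}b$, $u_0=A^{-1}b$, $v_0=A^{-T}\mathbf 1$, $F_0=A^{-1}$, converges to $x_*$, and the convergence is at least R-linear with rate $1/2$, i.e. $\limsup_{k\to\infty}\|x_*-u_k\|_1^{1/k}\le \tfrac12$.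
   Context: Let $n\ge 1$, let $a(z)=\sum_{i=1-n}^{n-1}a_iz^i$ have real coefficients, $T_n(a)$ the $n\times n$ Toeplitz matrix with $(T_n(a))_{i,j}=a_{j-i}$, and $\|a\|_{W}:=\sum_{i=1-n}^{n-1}|a_i|$. Set $A=(2-\|a\|_{W})I-T_n(a)$ and let $b\in\mathbb R^n$ be nonnegative and nonzero. Standing assumptions: $T_n(a)\ge 0$ (entrywise), $\|a\|_{W}+\|b\|_1<1$ and $\|b\|_1<(1-\|a\|_{W})^2$. Under these assumptions the equation $Ax-\|x\|_1x=b$ has exactly one solution with $\|x\|_1<1-\|a\|_{W}$. $\mathbf 1\in\mathbb R^n$ is the all-ones vector, $c_k\in\mathbb R$, $u_k,v_k\in\mathbb R^n$, $F_k\in\mathbb R^{n\times n}$. $\|\cdot\|_1$ is the vector 1-norm. *)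

theory Defs
  imports "HOL-Analysis.Analysis"
begin

text \<open>
  Vectors in $R^n$ are elements of \<open>real ^ 'n\<close>, where \<open>'n\<close> is a finite linearly ordered type
  with \<open>n = CARD('n)\<close> elements.  The order is needed only because the entries of a Toeplitz matrix
  depend on the difference of the positions of its indices; \<open>idx i\<close> is the 0-based position of
  \<open>i\<close>, so \<open>idx\<close> is the order isomorphism from \<open>'n\<close> onto \<open>{0..<n}\<close>.
  The synonyms \<open>'n rvec\<close> and \<open>'n rmat\<close> are \<open>real ^ 'n\<close> and \<open>real ^ 'n ^ 'n\<close>, written without the
  sort constraint \<open>finite\<close> that this syntax adds and that clashes with \<open>{finite,linorder}\<close>.
\<close>

type_synonym 'n rvec = "(real, 'n) vec"
type_synonym 'n rmat = "((real, 'n) vec, 'n) vec"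

definition idx :: "'n::{finite,linorder} \<Rightarrow> nat" where
  "idx i = card {j. j < i}"

text \<open>
  The Laurent polynomial $a(z) = \sum_{i=1-n}^{n-1} a_i z^i$ is represented by its coefficient
  function \<open>a :: int \<Rightarrow> real\<close>.  Values of \<open>a\<close> outside the range \<open>{1 - n..n - 1}\<close> are never used.
\<close>

definition toeplitz :: "(int \<Rightarrow> real) \<Rightarrow> ('n::{finite,linorder}) rmat" where
  "toeplitz a = (\<chi> i j. a (int (idx j) - int (idx i)))"

definition wiener_norm :: "nat \<Rightarrow> (int \<Rightarrow> real) \<Rightarrow> real" where
  "wiener_norm n a = (\<Sum>i = 1 - int n..int n - 1. \<bar>a i\<bar>)"

definition norm1 :: "('n::finite) rvec \<Rightarrow> real" where
  "norm1 x = (\<Sum>i\<in>UNIV. \<bar>x $ i\<bar>)"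

definition ones :: "('n::finite) rvec" where
  "ones = (\<chi> i. 1)"

definition outer :: "('n::finite) rvec \<Rightarrow> 'n rvec \<Rightarrow> 'n rmat" where
  "outer u v = (\<chi> i j. u $ i * v $ j)"

end

theory Submission
  imports Defs
begin

text \<open>
  Put \<open>\<lambda> = norm1 xs\<close>.  The column sums of \<open>A\<close> are at least \<open>2 - 2 * w > 2 * \<lambda>\<close> and its off-diagonal
  entries are nonpositive, so \<open>A - \<lambda> I\<close> is a nonsingular M-matrix.  Hence \<open>xs = (A - \<lambda> I)\<inverse> b\<close> is
  nonnegative and \<open>\<lambda> = 1\<^sup>T xs\<close>, which removes the absolute values from the equation.

  The recursion is the structure-preserving doubling algorithm for the matrix pencil attached to the
  quadratic equation.  Doubling squares the spectral data of the pencil and keeps its invariant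
  subspaces.  One of these belongs to \<open>xs\<close> and \<open>\<lambda>\<close>, the complementary one to the row vector
  \<open>y\<^sup>T = 1\<^sup>T (A - \<lambda> I)\<inverse>\<close> and the matrix \<open>T = (A - b y\<^sup>T)\<inverse>\<close>.  With \<open>L = \<lambda> ^ (2 ^ k)\<close> and
  \<open>S = T ^ (2 ^ k)\<close> this says, for every \<open>k\<close>,
  \[ c_k = L (1 - v_k^T x_*), \quad x_* - u_k = L F_k x_*, \quad
     c_k y^T S = y^T - v_k^T, \quad F_k = (I - u_k y^T) S . \]
  Together with nonnegativity of \<open>c\<close>, \<open>u\<close>, \<open>v\<close>, \<open>F\<close> these identities are preserved by the recursion
  (lemma \<open>invariant\<close>): they give \<open>u k \<le> xs\<close> and \<open>v k \<le> y\<close>, hence \<open>v k \<bullet> u k \<le> y \<bullet> xs < 1\<close>, so that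
  the next step is well defined, and the inverse in it is given by the Sherman-Morrison formula.

  For the speed, dominance of the columns bounds the entries of \<open>y\<close> by \<open>\<rho> = 1 / (2 - 2 * w - \<lambda>)\<close>.
  Since \<open>1\<^sup>T T = y\<^sup>T\<close>, the column sums of \<open>T ^ (2 ^ k)\<close> are at most \<open>\<rho> ^ (2 ^ k)\<close>.  The identities
  then yield \<open>norm1 (xs - u k) \<le> \<lambda> * (\<lambda> * \<rho>) ^ (2 ^ k)\<close> (lemma \<open>error_bound\<close>), where
  \<open>\<lambda> * \<rho> < 1\<close> because \<open>\<lambda> < 1 - w\<close>.  This is quadratic convergence, so eventually the error is
  below \<open>(1 / 2) ^ k\<close>.
\<close>

section \<open>Matrices with dominant column sums\<close>

text \<open>
  For \<open>d > 0\<close> such a matrix is a column diagonally dominant M-matrix.  The margin \<open>d\<close> is kept as a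
  parameter because it bounds the inverse quantitatively.
\<close>

definition col_dom :: "real \<Rightarrow> real ^ 'n ^ 'n \<Rightarrow> bool" where
  "col_dom d B \<longleftrightarrow> (\<forall>i j. i \<noteq> j \<longrightarrow> B $ i $ j \<le> 0) \<and> (\<forall>j. d \<le> (\<Sum>i\<in>UNIV. B $ i $ j))"

lemma inner_ones: "ones \<bullet> z = (\<Sum>i\<in>UNIV. z $ i)"
  by (simp add: inner_vec_def ones_def)

lemma ones_nonneg: "0 \<le> (ones :: real ^ 'n)"
  by (simp add: less_eq_vec_def ones_def)

lemma norm1_nonneg_vec: "0 \<le> z \<Longrightarrow> norm1 z = ones \<bullet> z"
  by (simp add: norm1_def inner_ones less_eq_vec_def)

lemma outer_mult_vec: "outer p q *v z = (q \<bullet> z) *\<^sub>R p"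
  by (simp add: vec_eq_iff matrix_vector_mult_def outer_def inner_vec_def sum_distrib_left
      sum_distrib_right mult_ac)

lemma mat_mult_vec: "mat s *v z = s *\<^sub>R (z :: real ^ 'n)"
  by (simp add: vec_eq_iff matrix_vector_mult_def mat_def if_distrib[of "\<lambda>t. t * _"]
      cong: if_cong)

lemma col_dom_diff_mat:
  assumes "col_dom d B"
  shows "col_dom (d - s) (B - mat s)"
proof -
  have "(\<Sum>i\<in>UNIV. (B - mat s) $ i $ j) = (\<Sum>i\<in>UNIV. B $ i $ j) - s" for j
    by (simp add: mat_def sum_subtractf)
  then show ?thesis
    using assms by (auto simp: col_dom_def mat_def)
qed

lemma col_dom_diff_outer:
  assumes "col_dom d B" and "0 \<le> p" "0 \<le> q" and q: "\<And>j. q $ j \<le> r"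
  shows "col_dom (d - (ones \<bullet> p) * r) (B - outer p q)"
proof -
  have pq: "0 \<le> p $ i" "0 \<le> q $ i" for i
    using assms by (auto simp: less_eq_vec_def)
  have sums: "(\<Sum>i\<in>UNIV. (B - outer p q) $ i $ j) = (\<Sum>i\<in>UNIV. B $ i $ j) - (ones \<bullet> p) * q $ j"
    for j
    by (simp add: outer_def sum_subtractf inner_ones sum_distrib_right)
  have le: "(ones \<bullet> p) * q $ j \<le> (ones \<bullet> p) * r" for j
    using q pq by (intro mult_left_mono) (auto simp: inner_ones intro: sum_nonneg)
  have "d - (ones \<bullet> p) * r \<le> (\<Sum>i\<in>UNIV. (B - outer p q) $ i $ j)" for j
  proof -
    have "d \<le> (\<Sum>i\<in>UNIV. B $ i $ j)"
      using assms(1) by (simp add: col_dom_def)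
    then show ?thesis
      using le[of j] unfolding sums by linarith
  qed
  moreover have "(B - outer p q) $ i $ j \<le> 0" if "i \<noteq> j" for i j
  proof -
    have "B $ i $ j \<le> 0"
      using assms(1) that by (simp add: col_dom_def)
    moreover have "0 \<le> p $ i * q $ j"
      using pq by simp
    ultimately show ?thesis
      by (simp add: outer_def)
  qed
  ultimately show ?thesis
    by (simp add: col_dom_def)
qed

text \<open>
  Inverse positivity, without a Neumann series: add up the rows of \<open>B *v z\<close> over the set \<open>S\<close> of
  indices at which \<open>z\<close> is negative.  In the columns in \<open>S\<close> the partial column sums are at least \<open>d\<close>,
  in all other columns they are nonpositive; so the total would be negative.
\<close>

lemma col_dom_nonnegI:
  assumes B: "col_dom d B" and d: "0 < d" and Bz: "0 \<le> B *v z"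
  shows "0 \<le> z"
proof (rule ccontr)
  assume "\<not> 0 \<le> z"
  define S where "S = {i. z $ i < 0}"
  have "S \<noteq> {}"
    using \<open>\<not> 0 \<le> z\<close> by (auto simp: S_def less_eq_vec_def not_le)
  have off: "B $ i $ j \<le> 0" if "i \<noteq> j" for i j
    using B that by (simp add: col_dom_def)
  have "0 \<le> (\<Sum>i\<in>S. (B *v z) $ i)"
    using Bz by (intro sum_nonneg) (simp add: less_eq_vec_def)
  also have "\<dots> = (\<Sum>j\<in>UNIV. z $ j * (\<Sum>i\<in>S. B $ i $ j))"
    unfolding matrix_vector_mult_def vec_lambda_beta
    by (subst sum.swap) (simp add: sum_distrib_left mult.commute)
  also have "\<dots> \<le> (\<Sum>j\<in>UNIV. if j \<in> S then z $ j * d else 0)"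
  proof (intro sum_mono)
    fix j
    show "z $ j * (\<Sum>i\<in>S. B $ i $ j) \<le> (if j \<in> S then z $ j * d else 0)"
    proof (cases "j \<in> S")
      case True
      have "d \<le> (\<Sum>i\<in>UNIV. B $ i $ j)"
        using B by (simp add: col_dom_def)
      also have "\<dots> = (\<Sum>i\<in>S. B $ i $ j) + (\<Sum>i\<in>- S. B $ i $ j)"
        by (simp add: sum.subset_diff[of S UNIV] Compl_eq_Diff_UNIV)
      (* the diagonal entry of column j lies in S, so only off-diagonal entries are dropped *)
      also have "\<dots> \<le> (\<Sum>i\<in>S. B $ i $ j) + 0"
        using True by (intro add_left_mono sum_nonpos off) auto
      finally have "d \<le> (\<Sum>i\<in>S. B $ i $ j)"
        by simp
      then show ?thesis
        using True by (simp add: S_def mult_left_mono_neg)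
    next
      case False
      then have "(\<Sum>i\<in>S. B $ i $ j) \<le> 0"
        by (intro sum_nonpos off) auto
      then show ?thesis
        using False by (simp add: S_def mult_nonneg_nonpos)
    qed
  qed
  also have "\<dots> = (\<Sum>j\<in>S. z $ j * d)"
    by (simp add: sum.If_cases)
  also have "\<dots> < 0"
    using \<open>S \<noteq> {}\<close> d sum_strict_mono[of S "\<lambda>j. z $ j * d" "\<lambda>_. 0"]
    by (auto simp: S_def mult_neg_pos)
  finally show False
    by simp
qed

lemma matrix_inv_cancel:
  fixes B :: "real ^ 'n ^ 'n"
  assumes "invertible B"
  shows "B *v (matrix_inv B *v z) = z" "matrix_inv B *v (B *v z) = z"
proof -
  have "B ** matrix_inv B = mat 1 \<and> matrix_inv B ** B = mat 1"
    using assms unfolding invertible_def matrix_inv_def by (rule someI_ex)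
  then show "B *v (matrix_inv B *v z) = z" "matrix_inv B *v (B *v z) = z"
    by (simp_all add: matrix_vector_mul_assoc)
qed

lemma col_dom_invertible:
  assumes "col_dom d B" "0 < d"
  shows "invertible B"
proof -
  have "z = 0" if "B *v z = 0" for z
  proof (rule antisym)
    show "0 \<le> z"
      by (rule col_dom_nonnegI[OF assms]) (simp add: that)
    have "B *v (- z) = 0"
      by (simp add: that vec.neg)
    then have "0 \<le> - z"
      using col_dom_nonnegI[OF assms, of "- z"] by simp
    then show "z \<le> 0"
      by simp
  qed
  then show ?thesis
    unfolding invertible_left_inverse matrix_left_invertible_ker by blast
qed

lemma col_dom_inv_nonneg:
  assumes "col_dom d B" "0 < d" "0 \<le> z"
  shows "0 \<le> matrix_inv B *v z"
  by (rule col_dom_nonnegI[OF assms(1,2)])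
    (simp add: matrix_inv_cancel(1)[OF col_dom_invertible[OF assms(1,2)]] assms(3))

text \<open>
  Each column of \<open>B\<close> sums to at least \<open>d\<close>, so \<open>B\<close> multiplies the sum of the entries of a nonnegative
  vector by at least \<open>d\<close>; apply this to \<open>matrix_inv B *v z\<close>.
\<close>

lemma col_dom_ones_inv_le:
  assumes B: "col_dom d B" "0 < d" and "0 \<le> z"
  shows "ones \<bullet> (matrix_inv B *v z) \<le> ones \<bullet> z / d"
proof -
  define q where "q = matrix_inv B *v z"
  have "0 \<le> q"
    unfolding q_def by (rule col_dom_inv_nonneg[OF assms])
  have "(\<Sum>j\<in>UNIV. q $ j * d) \<le> (\<Sum>j\<in>UNIV. q $ j * (\<Sum>i\<in>UNIV. B $ i $ j))"
    using \<open>0 \<le> q\<close> B by (intro sum_mono mult_left_mono) (auto simp: less_eq_vec_def col_dom_def)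
  also have "\<dots> = ones \<bullet> (B *v q)"
    unfolding inner_ones matrix_vector_mult_def vec_lambda_beta
    by (subst sum.swap) (simp add: sum_distrib_left mult.commute)
  also have "\<dots> = ones \<bullet> z"
    unfolding q_def by (simp add: matrix_inv_cancel col_dom_invertible[OF B])
  finally have "(ones \<bullet> q) * d \<le> ones \<bullet> z"
    by (simp add: inner_ones sum_distrib_right)
  then show ?thesis
    using B by (simp add: q_def field_simps)
qed

lemma sherman_morrison:
  fixes p q :: "real ^ 'n"
  assumes "q \<bullet> p \<noteq> 1"
  shows "invertible (mat 1 - outer p q)"
    and "matrix_inv (mat 1 - outer p q) *v z = z + (inverse (1 - q \<bullet> p) * (q \<bullet> z)) *\<^sub>R p"
proof -
  let ?M = "mat 1 - outer p q" and ?d = "inverse (1 - q \<bullet> p)"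
  have M: "?M *v z = z - (q \<bullet> z) *\<^sub>R p" for z
    by (simp add: matrix_vector_mult_diff_rdistrib outer_mult_vec)
  have 1: "?M *v (z + (?d * (q \<bullet> z)) *\<^sub>R p) = z" for z
  proof -
    have "?d * (q \<bullet> z) = (q \<bullet> z) + (?d * (q \<bullet> z)) * (q \<bullet> p)"
      using assms by (simp add: field_simps)
    then show ?thesis
      unfolding M by (simp add: inner_add_right flip: scaleR_left_distrib)
  qed
  have "z = 0" if "?M *v z = 0" for z
  proof -
    have z: "z = (q \<bullet> z) *\<^sub>R p"
      using that by (simp add: M)
    have "q \<bullet> z = q \<bullet> ((q \<bullet> z) *\<^sub>R p)"
      by (subst z[symmetric]) (rule refl)
    then have "(q \<bullet> z) = (q \<bullet> z) * (q \<bullet> p)"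
      by simp
    then have "q \<bullet> z = 0"
      using assms by (metis mult_cancel_left1)
    then show ?thesis
      using z by simp
  qed
  then show inv: "invertible ?M"
    unfolding invertible_left_inverse matrix_left_invertible_ker by blast
  show "matrix_inv ?M *v z = z + (?d * (q \<bullet> z)) *\<^sub>R p"
    using matrix_inv_cancel(2)[OF inv, of "z + (?d * (q \<bullet> z)) *\<^sub>R p"] unfolding 1 .
qed

section \<open>The doubling iteration\<close>

text \<open>
  The Toeplitz structure matters only through \<open>col_dom d A\<close>.  In the equation for \<open>x\<close> the norm is
  replaced by the linear functional \<open>ones\<close>; both agree on nonnegative vectors.
\<close>

locale doubling_iteration =
  fixes A :: "real ^ 'n ^ 'n" and b x :: "real ^ 'n" and d lam :: real
    and c :: "nat \<Rightarrow> real" and u v :: "nat \<Rightarrow> real ^ 'n" and F :: "nat \<Rightarrow> real ^ 'n ^ 'n"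
  assumes dom: "col_dom d A"
    and b_nonneg: "0 \<le> b"
    and b_small: "ones \<bullet> b < (d / 2)\<^sup>2"
    and x_eq: "A *v x = b + lam *\<^sub>R x"
    and lam_eq: "lam = ones \<bullet> x"
    and lam_nonneg: "0 \<le> lam"
    and lam_less: "lam < d / 2"
    and c_0: "c 0 = ones \<bullet> (matrix_inv A *v b)"
    and u_0: "u 0 = matrix_inv A *v b"
    and v_0: "v 0 = transpose (matrix_inv A) *v ones"
    and F_0: "F 0 = matrix_inv A"
    and c_Suc: "\<And>k. c (Suc k) = c k * inverse (1 - v k \<bullet> u k) * c k"
    and u_Suc: "\<And>k. u (Suc k) =
        u k + c k *\<^sub>R ((F k ** matrix_inv (mat 1 - outer (u k) (v k))) *v u k)"
    and v_Suc: "\<And>k. v (Suc k) =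
        v k + (c k * inverse (1 - v k \<bullet> u k)) *\<^sub>R (transpose (F k) *v v k)"
    and F_Suc: "\<And>k. F (Suc k) = F k ** matrix_inv (mat 1 - outer (u k) (v k)) ** F k"
begin

text \<open>
  The left counterpart of \<open>x\<close>: since \<open>y \<bullet> b = lam\<close> (lemma \<open>y_b\<close>), it solves the dual equation
  $A^T y = \mathbf 1 + (b^T y) y$.
\<close>

definition y :: "real ^ 'n" where
  "y = transpose (matrix_inv (A - mat lam)) *v ones"

text \<open>
  This matrix carries the part of the spectrum of the pencil that lies outside the disc of radius \<open>lam\<close>,
  in inverted form.
\<close>

definition T :: "real ^ 'n ^ 'n" where
  "T = matrix_inv (A - outer b y)"

text \<open>The power $T^{2^k}$, by repeated squaring as in the recursion for \<open>F\<close>.\<close>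

primrec T_pow :: "nat \<Rightarrow> real ^ 'n ^ 'n" where
  "T_pow 0 = T"
| "T_pow (Suc k) = T_pow k ** T_pow k"

definition rho :: real where
  "rho = 1 / (d - lam)"

lemma d_pos: "0 < d"
  using lam_nonneg lam_less by linarith

lemma gap_pos: "0 < d - lam"
  using lam_nonneg lam_less by linarith

lemma rho_pos: "0 < rho"
  using gap_pos by (simp add: rho_def)

lemma lam_rho_less_1: "lam * rho < 1"
  using gap_pos lam_less by (simp add: rho_def field_simps)

lemma dom_shift: "col_dom (d - lam) (A - mat lam)"
  by (rule col_dom_diff_mat[OF dom])

lemma x_nonneg: "0 \<le> x"
proof -
  have "(A - mat lam) *v x = b"
    by (simp add: matrix_vector_mult_diff_rdistrib mat_mult_vec x_eq)
  then show ?thesis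
    using b_nonneg col_dom_nonnegI[OF dom_shift gap_pos, of x] by simp
qed

lemma y_inner: "y \<bullet> z = ones \<bullet> (matrix_inv (A - mat lam) *v z)"
  unfolding y_def transpose_matrix_vector by (rule dot_lmul_matrix)

lemma y_A: "y \<bullet> (A *v z) = ones \<bullet> z + lam * (y \<bullet> z)"
proof -
  have "y \<bullet> ((A - mat lam) *v z) = ones \<bullet> z"
    by (simp add: y_inner matrix_inv_cancel col_dom_invertible[OF dom_shift gap_pos])
  then show ?thesis
    by (simp add: matrix_vector_mult_diff_rdistrib mat_mult_vec inner_diff_right)
qed

text \<open>
  Pairing \<open>A *v x = b + lam *\<^sub>R x\<close> with \<open>y\<close> shows that the dual equation has the same multiplier \<open>lam\<close>.
\<close>

lemma y_b: "y \<bullet> b = lam"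
  using y_A[of x] by (simp add: x_eq inner_add_right lam_eq)

lemma y_inner_nonneg: "0 \<le> z \<Longrightarrow> 0 \<le> y \<bullet> z"
  unfolding y_inner
  by (intro inner_nonneg_nonneg ones_nonneg col_dom_inv_nonneg[OF dom_shift gap_pos])

lemma y_inner_le: "0 \<le> z \<Longrightarrow> y \<bullet> z \<le> rho * (ones \<bullet> z)"
  using col_dom_ones_inv_le[OF dom_shift gap_pos] by (simp add: y_inner rho_def)

lemma axis_nonneg: "0 \<le> (axis i 1 :: real ^ 'n)"
  by (simp add: less_eq_vec_def axis_def)

lemma y_nonneg: "0 \<le> y"
  using y_inner_nonneg[OF axis_nonneg] by (simp add: less_eq_vec_def inner_axis)

lemma y_le_rho: "y $ j \<le> rho"
proof -
  have "ones \<bullet> (axis j 1 :: real ^ 'n) = 1"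
    by (simp add: inner_axis ones_def)
  then show ?thesis
    using y_inner_le[OF axis_nonneg, of j] by (simp add: inner_axis)
qed

lemma y_x_less_1: "y \<bullet> x < 1"
  using y_inner_le[OF x_nonneg] lam_rho_less_1 by (simp add: lam_eq mult.commute)

lemma dom_deflated: "col_dom (d - (ones \<bullet> b) * rho) (A - outer b y)"
  by (rule col_dom_diff_outer[OF dom b_nonneg y_nonneg y_le_rho])

text \<open>
  The bounds \<open>ones \<bullet> b < (d / 2)\<^sup>2\<close> and \<open>rho \<le> 2 / d\<close> show that subtracting \<open>outer b y\<close> from \<open>A\<close> costs
  at most half of the dominance \<open>d\<close>.
\<close>

lemma deflated_pos: "0 < d - (ones \<bullet> b) * rho"
proof -
  have "(ones \<bullet> b) * rho \<le> (d / 2)\<^sup>2 * rho"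
    using b_small rho_pos by (intro mult_right_mono) auto
  also have "\<dots> \<le> (d / 2)\<^sup>2 * (2 / d)"
    using lam_less gap_pos d_pos by (intro mult_left_mono) (auto simp: rho_def field_simps)
  also have "\<dots> < d"
    using d_pos by (simp add: power2_eq_square)
  finally show ?thesis
    by simp
qed

lemma T_cancel: "A *v (T *v z) - (y \<bullet> (T *v z)) *\<^sub>R b = z"
  using matrix_inv_cancel(1)[OF col_dom_invertible[OF dom_deflated deflated_pos], of z]
  by (simp add: T_def matrix_vector_mult_diff_rdistrib outer_mult_vec)

text \<open>
  Equivalent to \<open>y\<^sup>T (A - b y\<^sup>T) = 1\<^sup>T\<close>, which is the dual equation for \<open>y\<close>.  It makes the entries of
  \<open>y\<close> the column sums of \<open>T\<close>.
\<close>

lemma ones_T: "ones \<bullet> (T *v z) = y \<bullet> z"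
proof -
  have "y \<bullet> z = y \<bullet> (A *v (T *v z) - (y \<bullet> (T *v z)) *\<^sub>R b)"
    by (simp only: T_cancel)
  then show ?thesis
    by (simp add: inner_diff_right y_A y_b)
qed

lemma T_pow_nonneg: "0 \<le> z \<Longrightarrow> 0 \<le> T_pow k *v z"
  by (induction k arbitrary: z)
    (simp_all add: T_def col_dom_inv_nonneg[OF dom_deflated deflated_pos]
      flip: matrix_vector_mul_assoc)

lemma ones_T_pow_le: "0 \<le> z \<Longrightarrow> ones \<bullet> (T_pow k *v z) \<le> rho ^ (2 ^ k) * (ones \<bullet> z)"
proof (induction k arbitrary: z)
  case 0
  then show ?case
    by (simp add: ones_T y_inner_le)
next
  case (Suc k)
  have "ones \<bullet> (T_pow (Suc k) *v z) \<le> rho ^ (2 ^ k) * (ones \<bullet> (T_pow k *v z))"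
    using Suc.IH[OF T_pow_nonneg[OF Suc.prems, of k]] by (simp flip: matrix_vector_mul_assoc)
  also have "\<dots> \<le> rho ^ (2 ^ k) * (rho ^ (2 ^ k) * (ones \<bullet> z))"
    using rho_pos by (intro mult_left_mono Suc.IH Suc.prems) simp
  also have "\<dots> = rho ^ (2 ^ Suc k) * (ones \<bullet> z)"
    by (simp add: mult_2 power_add)
  finally show ?case .
qed

text \<open>
  The first two identities say that $(1, x)$ spans a deflating subspace of the \<open>k\<close>-th pencil with
  eigenvalue $\lambda^{2^k}$, the next two that $(y^T, I)$ does so with $T^{2^k}$.  Products with \<open>F k\<close>,
  and nonnegativity of \<open>F k\<close>, are stated through the action on vectors, so that no transposes appear.
\<close>

definition invariant :: "nat \<Rightarrow> bool" where
  "invariant k \<longleftrightarrow>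
     c k = lam ^ (2 ^ k) * (1 - v k \<bullet> x) \<and>
     x - u k = lam ^ (2 ^ k) *\<^sub>R (F k *v x) \<and>
     (\<forall>z. c k * (y \<bullet> (T_pow k *v z)) = y \<bullet> z - v k \<bullet> z) \<and>
     (\<forall>z. F k *v z = T_pow k *v z - (y \<bullet> (T_pow k *v z)) *\<^sub>R u k) \<and>
     0 \<le> c k \<and> 0 \<le> u k \<and> 0 \<le> v k \<and> (\<forall>z. 0 \<le> z \<longrightarrow> 0 \<le> F k *v z)"

lemma invariant_0: "invariant 0"
proof -
  note cancel = matrix_inv_cancel[OF col_dom_invertible[OF dom d_pos]]
  note nonneg = col_dom_inv_nonneg[OF dom d_pos]
  have v0: "v 0 \<bullet> z = ones \<bullet> (matrix_inv A *v z)" for z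
    unfolding v_0 transpose_matrix_vector by (rule dot_lmul_matrix)
  have x: "x - u 0 = lam *\<^sub>R (matrix_inv A *v x)"
    using cancel(2)[of x]
    by (simp add: u_0 x_eq matrix_vector_right_distrib matrix_vector_mult_scaleR algebra_simps)
  have F: "F 0 *v z = T *v z - (y \<bullet> (T *v z)) *\<^sub>R u 0" for z
  proof -
    have "F 0 *v z = matrix_inv A *v (A *v (T *v z) - (y \<bullet> (T *v z)) *\<^sub>R b)"
      by (simp add: T_cancel F_0)
    then show ?thesis
      by (simp only: matrix_vector_mult_diff_distrib matrix_vector_mult_scaleR cancel u_0)
  qed
  have c: "c 0 = lam * (1 - v 0 \<bullet> x)"
  proof -
    have "ones \<bullet> (x - u 0) = lam * (v 0 \<bullet> x)"
      by (simp add: x v0)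
    then show ?thesis
      by (simp add: inner_diff_right c_0 lam_eq[symmetric] flip: u_0) (simp add: algebra_simps)
  qed
  have V: "c 0 * (y \<bullet> (T *v z)) = y \<bullet> z - v 0 \<bullet> z" for z
  proof -
    have "v 0 \<bullet> z = ones \<bullet> (T *v z) - (y \<bullet> (T *v z)) * c 0"
      using F[of z] by (simp add: v0 F_0 c_0 inner_diff_right flip: u_0)
    then show ?thesis
      by (simp add: ones_T)
  qed
  have "0 \<le> v 0"
    using inner_nonneg_nonneg[OF ones_nonneg nonneg[OF axis_nonneg]] v0[of "axis _ 1"]
    by (simp add: less_eq_vec_def inner_axis)
  moreover have "0 \<le> c 0" "0 \<le> u 0"
    using nonneg[OF b_nonneg] inner_nonneg_nonneg[OF ones_nonneg nonneg[OF b_nonneg]]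
    by (simp_all add: c_0 u_0)
  ultimately show ?thesis
    using c x F V nonneg by (simp add: invariant_def F_0)
qed

text \<open>
  The invariant makes \<open>x - u k\<close> and \<open>y - v k\<close> nonnegative, so \<open>v k \<bullet> u k \<le> y \<bullet> x \<le> lam * rho < 1\<close>.
\<close>

lemma v_u_less_1:
  assumes "invariant k"
  shows "v k \<bullet> u k < 1"
proof -
  have I: "x - u k = lam ^ (2 ^ k) *\<^sub>R (F k *v x)"
    "c k * (y \<bullet> (T_pow k *v z)) = y \<bullet> z - v k \<bullet> z"
    "0 \<le> c k" "0 \<le> u k" "0 \<le> v k" "0 \<le> F k *v x" for z
    using assms x_nonneg by (auto simp: invariant_def)
  have "0 \<le> x - u k"
    unfolding I(1) using I lam_nonneg by (intro scaleR_nonneg_nonneg) auto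
  then have "v k \<bullet> u k \<le> v k \<bullet> x"
    using inner_nonneg_nonneg[OF I(5), of "x - u k"] by (simp add: inner_diff_right)
  also have "0 \<le> y \<bullet> x - v k \<bullet> x"
    unfolding I(2)[symmetric] using I(3) T_pow_nonneg[OF x_nonneg] y_inner_nonneg by simp
  then have "v k \<bullet> x \<le> y \<bullet> x"
    by simp
  finally show ?thesis
    using y_x_less_1 by simp
qed

text \<open>
  With $e = 1 / (1 - v_k^T u_k)$ the inverse in the recursion is $W = I + e\, u_k v_k^T$, and
  \<open>W *v u k = e *\<^sub>R u k\<close>.  Each identity for \<open>Suc k\<close> then follows from the old four by bilinear algebra and
  the relation \<open>e * (v k \<bullet> u k) = e - 1\<close>; nonnegativity is visible in the update formulas as \<open>e > 0\<close>.
\<close>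

lemma invariant_Suc:
  assumes inv: "invariant k"
  shows "invariant (Suc k)"
proof -
  define L where "L = lam ^ (2 ^ k)"
  define e where "e = inverse (1 - v k \<bullet> u k)"
  define W where "W = matrix_inv (mat 1 - outer (u k) (v k))"
  have L2: "lam ^ (2 ^ Suc k) = L * L"
    by (simp add: L_def mult_2 power_add)
  have e: "e * (1 - v k \<bullet> u k) = 1" "0 < e"
    using v_u_less_1[OF inv] by (auto simp: e_def)
  have e': "e * (v k \<bullet> u k) = e - 1"
    using e(1) by (simp add: algebra_simps)
  have c: "c k = L * (1 - v k \<bullet> x)"
    and x: "L *\<^sub>R (F k *v x) = x - u k"
    and V: "c k * (y \<bullet> (T_pow k *v z)) = y \<bullet> z - v k \<bullet> z"
    and F: "F k *v z = T_pow k *v z - (y \<bullet> (T_pow k *v z)) *\<^sub>R u k"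
    and nonneg: "0 \<le> c k" "0 \<le> u k" "0 \<le> v k" "0 \<le> z \<Longrightarrow> 0 \<le> F k *v z" for z
    using inv by (auto simp: invariant_def L_def)
  have W: "W *v z = z + (e * (v k \<bullet> z)) *\<^sub>R u k" for z
    unfolding W_def e_def using v_u_less_1[OF inv] by (intro sherman_morrison) simp
  have Wu: "W *v u k = e *\<^sub>R u k"
    unfolding W e' by (simp add: algebra_simps)
  have u': "u (Suc k) = u k + (c k * e) *\<^sub>R (F k *v u k)"
    by (simp add: u_Suc Wu matrix_vector_mult_scaleR flip: W_def matrix_vector_mul_assoc)
  have v': "v (Suc k) \<bullet> z = v k \<bullet> z + (c k * e) * (v k \<bullet> (F k *v z))" for z
    by (simp add: v_Suc inner_add_left transpose_matrix_vector dot_lmul_matrix flip: e_def)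
  have F': "F (Suc k) *v z = F k *v (W *v (F k *v z))" for z
    by (simp add: F_Suc flip: W_def matrix_vector_mul_assoc)
  have c': "c (Suc k) = c k * e * c k"
    by (simp add: c_Suc e_def)
  have T_pow': "T_pow (Suc k) *v z = T_pow k *v (T_pow k *v z)" for z
    by (simp flip: matrix_vector_mul_assoc)

  have I1: "c (Suc k) = L * L * (1 - v (Suc k) \<bullet> x)"
  proof -
    have Lv: "L * (v k \<bullet> (F k *v x)) = v k \<bullet> x - v k \<bullet> u k"
      by (simp add: x inner_diff_right flip: inner_scaleR_right)
    have "L * L * (1 - v (Suc k) \<bullet> x)
        = L * (L * (1 - v k \<bullet> x)) - c k * L * (e * (L * (v k \<bullet> (F k *v x))))"
      unfolding v' by (simp add: algebra_simps)
    also have "\<dots> = L * c k - c k * L * (e * (v k \<bullet> x) - e * (v k \<bullet> u k))"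
      unfolding Lv c[symmetric] by (simp add: algebra_simps)
    also have "\<dots> = c k * e * (L * (1 - v k \<bullet> x))"
      unfolding e' by (simp add: algebra_simps)
    finally show ?thesis
      by (simp add: c' c[symmetric])
  qed

  have I2: "x - u (Suc k) = (L * L) *\<^sub>R (F (Suc k) *v x)"
  proof -
    have "L *\<^sub>R (W *v (F k *v x)) = W *v (x - u k)"
      unfolding x[symmetric] by (simp only: matrix_vector_mult_scaleR)
    also have "\<dots> = x + (e * (v k \<bullet> x)) *\<^sub>R u k - e *\<^sub>R u k"
      by (simp only: matrix_vector_mult_diff_distrib Wu) (simp add: W)
    also have "\<dots> = x - (e * (1 - v k \<bullet> x)) *\<^sub>R u k"
      by (simp add: algebra_simps)
    finally have LW: "L *\<^sub>R (W *v (F k *v x)) = x - (e * (1 - v k \<bullet> x)) *\<^sub>R u k" .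
    have "(L * L) *\<^sub>R (F (Suc k) *v x) = L *\<^sub>R (F k *v (L *\<^sub>R (W *v (F k *v x))))"
      by (simp add: F' matrix_vector_mult_scaleR)
    also have "\<dots> = L *\<^sub>R (F k *v (x - (e * (1 - v k \<bullet> x)) *\<^sub>R u k))"
      by (simp only: LW)
    also have "\<dots> = (x - u k) - (c k * e) *\<^sub>R (F k *v u k)"
      by (simp add: matrix_vector_mult_diff_distrib matrix_vector_mult_scaleR
          scaleR_diff_right x c mult_ac)
    finally show ?thesis
      by (simp add: u')
  qed

  have vF: "v k \<bullet> (F k *v z) = v k \<bullet> (T_pow k *v z) - (v k \<bullet> u k) * (y \<bullet> (T_pow k *v z))" for z
    by (simp add: F inner_diff_right)

  have I3: "c (Suc k) * (y \<bullet> (T_pow (Suc k) *v z)) = y \<bullet> z - v (Suc k) \<bullet> z" for z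
  proof -
    let ?q = "T_pow k *v z"
    have "c (Suc k) * (y \<bullet> (T_pow (Suc k) *v z)) = c k * e * (y \<bullet> ?q - v k \<bullet> ?q)"
      unfolding c' T_pow' V[of ?q, symmetric] by (simp only: mult.assoc)
    also have "\<dots> = c k * (y \<bullet> ?q) - c k * e * (v k \<bullet> ?q)
        + c k * (e - 1) * (y \<bullet> ?q)"
      by (simp add: algebra_simps)
    also have "\<dots> = c k * (y \<bullet> ?q) - c k * e * (v k \<bullet> (F k *v z))"
      unfolding vF e'[symmetric] by (simp add: algebra_simps)
    finally show ?thesis
      by (simp add: V v')
  qed

  have I4: "F (Suc k) *v z = T_pow (Suc k) *v z - (y \<bullet> (T_pow (Suc k) *v z)) *\<^sub>R u (Suc k)" for z
  proof -
    let ?q = "T_pow k *v z"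
    have "W *v (F k *v z) = W *v ?q - (y \<bullet> ?q) *\<^sub>R (W *v u k)"
      by (simp add: F matrix_vector_mult_diff_distrib matrix_vector_mult_scaleR)
    also have "\<dots> = ?q - (e * (y \<bullet> ?q - v k \<bullet> ?q)) *\<^sub>R u k"
      unfolding Wu by (simp add: W algebra_simps)
    also have "\<dots> = ?q - (c k * e * (y \<bullet> (T_pow k *v ?q))) *\<^sub>R u k"
      unfolding V[of ?q, symmetric] by (simp add: mult_ac)
    finally have "F (Suc k) *v z = F k *v ?q - (c k * e * (y \<bullet> (T_pow k *v ?q))) *\<^sub>R (F k *v u k)"
      unfolding F' by (simp add: matrix_vector_mult_diff_distrib matrix_vector_mult_scaleR)
    then show ?thesis
      by (simp only: F[of ?q] T_pow' u') (simp add: algebra_simps)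
  qed

  have "0 \<le> c k * e"
    using nonneg(1) e(2) by simp
  have v_nonneg: "0 \<le> z \<Longrightarrow> 0 \<le> v k \<bullet> z" for z
    using nonneg(3) by (rule inner_nonneg_nonneg)
  have "0 \<le> c (Suc k)"
    unfolding c' by (intro mult_nonneg_nonneg[OF \<open>0 \<le> c k * e\<close> nonneg(1)])
  moreover have "0 \<le> u (Suc k)"
    unfolding u' by (rule add_nonneg_nonneg[OF nonneg(2)
          scaleR_nonneg_nonneg[OF \<open>0 \<le> c k * e\<close> nonneg(4)[OF nonneg(2)]]])
  moreover have "0 \<le> v (Suc k) $ i" for i
  proof -
    have "0 \<le> v (Suc k) \<bullet> axis i 1"
      unfolding v' by (rule add_nonneg_nonneg[OF v_nonneg[OF axis_nonneg]
            mult_nonneg_nonneg[OF \<open>0 \<le> c k * e\<close> v_nonneg[OF nonneg(4)[OF axis_nonneg]]]])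
    then show ?thesis
      by (simp add: inner_axis)
  qed
  moreover have "0 \<le> F (Suc k) *v z" if "0 \<le> z" for z
  proof -
    have Fz: "0 \<le> F k *v z"
      using that by (rule nonneg(4))
    have "0 \<le> e * (v k \<bullet> (F k *v z))"
      using e(2) v_nonneg[OF Fz] by simp
    then show ?thesis
      unfolding F' W
      by (rule nonneg(4)[OF add_nonneg_nonneg[OF Fz scaleR_nonneg_nonneg[OF _ nonneg(2)]]])
  qed
  ultimately show ?thesis
    using I1 I2 I3 I4 unfolding invariant_def L2 by (simp add: less_eq_vec_def[of 0 "v (Suc k)"])
qed

lemma invariant: "invariant k"
  by (induction k) (simp_all add: invariant_0 invariant_Suc)

text \<open>
  As \<open>u k\<close> and \<open>y\<close> are nonnegative, \<open>F k\<close> is dominated by $T^{2^k}$ on nonnegative vectors, so the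
  identity $x - u_k = \lambda^{2^k} F_k x$ becomes an estimate.
\<close>

lemma error_bound: "norm1 (x - u k) \<le> lam * (lam * rho) ^ (2 ^ k)"
proof -
  let ?L = "lam ^ (2 ^ k)"
  have I: "x - u k = ?L *\<^sub>R (F k *v x)" "F k *v x = T_pow k *v x - (y \<bullet> (T_pow k *v x)) *\<^sub>R u k"
    "0 \<le> u k" "0 \<le> F k *v x"
    using invariant[of k] x_nonneg by (auto simp: invariant_def)
  have "0 \<le> x - u k"
    unfolding I(1) using I(4) lam_nonneg by (intro scaleR_nonneg_nonneg) auto
  then have "norm1 (x - u k) = ?L * (ones \<bullet> (F k *v x))"
    by (simp add: norm1_nonneg_vec I(1))
  also have "\<dots> \<le> ?L * (ones \<bullet> (T_pow k *v x))"
    using lam_nonneg y_inner_nonneg[OF T_pow_nonneg[OF x_nonneg, of k]]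
      inner_nonneg_nonneg[OF ones_nonneg I(3)]
    by (intro mult_left_mono) (auto simp: I(2) inner_diff_right)
  also have "\<dots> \<le> ?L * (rho ^ (2 ^ k) * lam)"
    using ones_T_pow_le[OF x_nonneg] lam_nonneg by (intro mult_left_mono) (auto simp: lam_eq)
  finally show ?thesis
    by (simp add: power_mult_distrib mult_ac)
qed

end

section \<open>Toeplitz matrices\<close>

lemma idx_strict_mono: "i < j \<Longrightarrow> idx i < idx j"
  unfolding idx_def by (rule psubset_card_mono) auto

lemma inj_idx: "inj idx"
  by (rule linorder_injI) (use idx_strict_mono in fastforce)

lemma idx_less: "idx (i :: 'n::{finite,linorder}) < CARD('n)"
  unfolding idx_def by (rule psubset_card_mono) auto

text \<open>
  Along a column the difference of positions takes each value at most once, so the column sum is part of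
  the sum that defines the Wiener norm.
\<close>

lemma toeplitz_col_sum_le:
  "(\<Sum>i\<in>UNIV. (toeplitz a :: ('n::{finite,linorder}) rmat) $ i $ j) \<le> wiener_norm CARD('n) a"
proof -
  let ?f = "\<lambda>i :: 'n. int (idx j) - int (idx i)"
  have "inj ?f"
    using inj_idx by (auto simp: inj_def)
  have "(\<Sum>i\<in>UNIV. (toeplitz a :: 'n rmat) $ i $ j) \<le> (\<Sum>i\<in>UNIV. \<bar>a (?f i)\<bar>)"
    by (intro sum_mono) (simp add: toeplitz_def)
  also have "\<dots> = (\<Sum>m\<in>range ?f. \<bar>a m\<bar>)"
    using \<open>inj ?f\<close> by (simp add: sum.reindex)
  also have "\<dots> \<le> wiener_norm CARD('n) a"
  proof -
    have "?f i \<in> {1 - int CARD('n)..int CARD('n) - 1}" for i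
      using idx_less[of i] idx_less[of j] by auto
    then show ?thesis
      unfolding wiener_norm_def by (intro sum_mono2) auto
  qed
  finally show ?thesis .
qed

lemma col_dom_toeplitz:
  assumes "\<And>i j. 0 \<le> (toeplitz a :: ('n::{finite,linorder}) rmat) $ i $ j"
  shows "col_dom (s - wiener_norm CARD('n) a) (mat s - toeplitz a :: 'n rmat)"
  using assms toeplitz_col_sum_le[of a]
  by (auto simp: col_dom_def mat_def sum_subtractf)

section \<open>Convergence\<close>

lemma norm1_nonneg: "0 \<le> norm1 z"
  by (simp add: norm1_def sum_nonneg)

lemma tendsto_norm1D:
  fixes z :: "real ^ 'n"
  assumes "(\<lambda>k. norm1 (z - f k)) \<longlonglongrightarrow> 0"
  shows "f \<longlonglongrightarrow> z"
proof -
  have "norm y \<le> norm1 y" for y :: "real ^ 'n"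
    unfolding norm1_def by (rule norm_le_l1_cart)
  then have "(\<lambda>k. z - f k) \<longlonglongrightarrow> 0"
    by (intro Lim_null_comparison[OF always_eventually assms]) blast
  from tendsto_diff[OF tendsto_const[of z] this] show ?thesis
    by simp
qed

text \<open>
  This is $m r^m \to 0$ along the subsequence $m = 2^k$.
\<close>

lemma power_double_eventually_le:
  fixes r C :: real
  assumes "0 \<le> r" "r < 1"
  shows "\<forall>\<^sub>F k in sequentially. C * r ^ (2 ^ k) \<le> (1 / 2) ^ k"
proof -
  have "(\<lambda>m. C * (of_nat m * r ^ m)) \<longlonglongrightarrow> C * 0"
    using assms by (intro tendsto_mult_left powser_times_n_limit_0) simp
  moreover have "filterlim (\<lambda>k. 2 ^ k :: nat) sequentially sequentially"
    by (rule filterlim_subseq) (simp add: strict_mono_def)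
  ultimately have "(\<lambda>k. C * (of_nat (2 ^ k) * r ^ (2 ^ k))) \<longlonglongrightarrow> C * 0"
    by (rule filterlim_compose)
  then have "\<forall>\<^sub>F k in sequentially. C * (of_nat (2 ^ k) * r ^ (2 ^ k)) < 1"
    by (rule order_tendstoD(2)) simp
  then show ?thesis
    by eventually_elim (simp add: power_divide field_simps)
qed

theorem theorem3p8:
  fixes a :: "int \<Rightarrow> real"
    and A :: "('n::{finite,linorder}) rmat"
    and b xs :: "'n rvec"
    and c :: "nat \<Rightarrow> real"
    and u v :: "nat \<Rightarrow> 'n rvec"
    and F :: "nat \<Rightarrow> 'n rmat"
    and w :: real
  assumes w: "w = wiener_norm CARD('n) a"
    and A: "A = mat (2 - w) - toeplitz a"
    and b_nonneg: "\<And>i. 0 \<le> b $ i"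
    and b_nonzero: "b \<noteq> 0"
    and T_nonneg: "\<And>i j. 0 \<le> (toeplitz a :: 'n rmat) $ i $ j"
    and small1: "w + norm1 b < 1"
    and small2: "norm1 b < (1 - w)\<^sup>2"
    and xs_sol: "A *v xs - norm1 xs *\<^sub>R xs = b"
    and xs_norm: "norm1 xs < 1 - w"
    and c_0: "c 0 = ones \<bullet> (matrix_inv A *v b)"
    and u_0: "u 0 = matrix_inv A *v b"
    and v_0: "v 0 = transpose (matrix_inv A) *v ones"
    and F_0: "F 0 = matrix_inv A"
    and c_Suc: "\<And>k. c (Suc k) = c k * inverse (1 - v k \<bullet> u k) * c k"
    and u_Suc: "\<And>k. u (Suc k) =
        u k + c k *\<^sub>R ((F k ** matrix_inv (mat 1 - outer (u k) (v k))) *v u k)"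
    and v_Suc: "\<And>k. v (Suc k) =
        v k + (c k * inverse (1 - v k \<bullet> u k)) *\<^sub>R (transpose (F k) *v v k)"
    and F_Suc: "\<And>k. F (Suc k) = F k ** matrix_inv (mat 1 - outer (u k) (v k)) ** F k"
  shows "invertible A
    \<and> (\<forall>k. 1 - v k \<bullet> u k \<noteq> 0 \<and> invertible (mat 1 - outer (u k) (v k)))
    \<and> u \<longlonglongrightarrow> xs
    \<and> limsup (\<lambda>k. ereal (root k (norm1 (xs - u k)))) \<le> ereal (1 / 2)"
proof -
  have d: "col_dom (2 - 2 * w) A"
    using col_dom_toeplitz[OF T_nonneg, of "2 - w"] by (simp add: A w)
  define lam where "lam = norm1 xs"
  have lam: "0 \<le> lam" "lam < (2 - 2 * w) / 2"
    using xs_norm norm1_nonneg by (auto simp: lam_def)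
  have b: "0 \<le> b"
    using b_nonneg by (simp add: less_eq_vec_def)
  have x_eq: "A *v xs = b + lam *\<^sub>R xs"
    using xs_sol by (simp add: lam_def algebra_simps)
  (* nonnegativity of xs is what turns the norm into the linear functional ones *)
  have "(A - mat lam) *v xs = b"
    by (simp add: matrix_vector_mult_diff_rdistrib mat_mult_vec x_eq)
  then have "0 \<le> xs"
    using b lam col_dom_nonnegI[OF col_dom_diff_mat[OF d, of lam], of xs] by simp
  then have lam_eq: "lam = ones \<bullet> xs"
    by (simp add: lam_def norm1_nonneg_vec)
  have b_lt: "ones \<bullet> b < ((2 - 2 * w) / 2)\<^sup>2"
    using small2 norm1_nonneg_vec[OF b] by (simp add: diff_divide_distrib)
  interpret doubling_iteration A b xs "2 - 2 * w" lam c u v F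
    by unfold_locales
      (fact d b b_lt x_eq lam_eq lam c_0 u_0 v_0 F_0 c_Suc u_Suc v_Suc F_Suc)+
  define r where "r = lam * rho"
  have r: "0 \<le> r" "r < 1"
    using lam rho_pos lam_rho_less_1 by (auto simp: r_def)
  have fast: "\<forall>\<^sub>F k in sequentially. norm1 (xs - u k) \<le> (1 / 2) ^ k"
    using power_double_eventually_le[OF r, of lam]
  proof eventually_elim
    case (elim k)
    then show ?case
      using error_bound[of k] by (simp add: r_def)
  qed
  have "(\<lambda>k. norm1 (xs - u k)) \<longlonglongrightarrow> 0"
  proof (rule tendsto_sandwich[OF _ fast tendsto_const])
    show "(\<lambda>k. (1 / 2) ^ k :: real) \<longlonglongrightarrow> 0"
      by (rule LIMSEQ_realpow_zero) auto
  qed (simp add: norm1_nonneg)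
  then have "u \<longlonglongrightarrow> xs"
    by (rule tendsto_norm1D)
  moreover have "limsup (\<lambda>k. ereal (root k (norm1 (xs - u k)))) \<le> ereal (1 / 2)"
  proof (rule Limsup_bounded)
    show "\<forall>\<^sub>F k in sequentially. ereal (root k (norm1 (xs - u k))) \<le> ereal (1 / 2)"
      using fast eventually_gt_at_top[of 0]
    proof eventually_elim
      case (elim k)
      then have "root k (norm1 (xs - u k)) \<le> root k ((1 / 2) ^ k)"
        by simp
      then show ?case
        using elim by (simp add: real_root_power_cancel)
    qed
  qed
  moreover have "1 - v k \<bullet> u k \<noteq> 0" "invertible (mat 1 - outer (u k) (v k))" for k
    using v_u_less_1[OF invariant, of k] sherman_morrison(1)[of "v k" "u k"] by auto
  ultimately show ?thesis
    using col_dom_invertible[OF d] lam by auto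
qed

end
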